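(* Let $M$ be an oriented surface immersed in $\mathbb{R}^3$, let $m\in M$, let $k_1,k_2$ be the principal curvatures of $M$ at $m$, and let $(t_1,t_2)$ be a positively oriented orthonormal basis of $T_mM$ formed by principal directions corresponding to $k_1$ and $k_2$ respectively. Let $v=\cos\theta\,t_1+\sin\theta\,t_2$ with $\cos\theta\neq 0$ and put $p=\tan\theta$. Then $v$ is an extremal direction of the lateral geodesic deviation of $M$ at $m$ if and only if $$(k_2-k_1)\big(-k_2p^4+ 3p^2(k_2-k_1)+ k_1\big)= 0.$$
   Context: $\alpha$ denotes the second fundamental form of $M$, $\alpha(X,Y)=(D_XY)^\bot$ (normal component of the directional derivative in $\mathbb{R}^3$), and $J$ denotes the positive rotation by 90 degrees in $T_mM$. For a unit vector $v\in T_mM$, the lateral (geodesic) deviation of $M$ in the direction $v$ is $-\frac16\alpha(Jv,v)\cdot\alpha(v,v)$. Writing unit vectors as $v(\theta)=\cos\theta\,t_1+\sin\theta\,t_2$, a direction $v(\theta_0)$ is called an extremal direction of the lateral deviation if the derivative with respect to $\theta$ of the lateral deviation in the direction $v(\theta)$ vanishes at $\theta_0$. *)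

theory Defs
  imports "HOL-Analysis.Analysis"
begin

text \<open>For open \<open>S\<close> and a finite-dimensional domain this is \<open>C\<^sup>k\<close> regularity, expressed through iterated
  directional derivatives.\<close>

primrec Ck_on ::
  "nat \<Rightarrow> ('a::real_normed_vector \<Rightarrow> 'b::real_normed_vector) \<Rightarrow> 'a set \<Rightarrow> bool" where
  "Ck_on 0 g S \<longleftrightarrow> continuous_on S g"
| "Ck_on (Suc k) g S \<longleftrightarrow>
     (\<forall>u\<in>S. g differentiable (at u)) \<and>
     (\<forall>v. Ck_on k (\<lambda>u. frechet_derivative g (at u) v) S)"

definition smooth_on ::
  "('a::real_normed_vector \<Rightarrow> 'b::real_normed_vector) \<Rightarrow> 'a set \<Rightarrow> bool" where
  "smooth_on g S \<longleftrightarrow> open S \<and> (\<forall>k. Ck_on k g S)"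

text \<open>A surface is a topological space with an atlas and a map into Euclidean 3-space.
  A chart is a local parametrization \<open>(U, x)\<close>, that is, \<open>x\<close> maps the open set \<open>U\<close> of the
  plane onto an open set of the surface.\<close>

record 'a surface =
  space_top :: "'a topology"
  charts :: "((real^2) set \<times> (real^2 \<Rightarrow> 'a)) set"
  imm :: "'a \<Rightarrow> real^3"

definition oriented_immersed_surface :: "'a surface \<Rightarrow> bool" where
  "oriented_immersed_surface M \<longleftrightarrow>
     Hausdorff_space (space_top M) \<and> second_countable (space_top M) \<and>
     topspace (space_top M) = (\<Union>(U, x)\<in>charts M. x ` U) \<and>
     (\<forall>(U, x)\<in>charts M. open U \<and> embedding_map (top_of_set U) (space_top M) x
        \<and> openin (space_top M) (x ` U)) \<and>
     (\<forall>(U, x)\<in>charts M. \<forall>(V, y)\<in>charts M.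
        smooth_on (inv_into V y \<circ> x) {u \<in> U. x u \<in> y ` V} \<and>
        (\<forall>u\<in>U. x u \<in> y ` V \<longrightarrow>
           det (matrix (frechet_derivative (inv_into V y \<circ> x) (at u))) > 0)) \<and>
     (\<forall>(U, x)\<in>charts M. smooth_on (imm M \<circ> x) U \<and>
        (\<forall>u\<in>U. inj (frechet_derivative (imm M \<circ> x) (at u))))"

definition chart_at ::
  "'a surface \<Rightarrow> 'a \<Rightarrow> (real^2) set \<Rightarrow> (real^2 \<Rightarrow> 'a) \<Rightarrow> real^2 \<Rightarrow> bool" where
  "chart_at M m U x u \<longleftrightarrow> (U, x) \<in> charts M \<and> u \<in> U \<and> x u = m"

text \<open>The tangent plane at \<open>m\<close>, seen as a linear subspace of Euclidean 3-space via the
  differential of the immersion.\<close>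

definition tangent_plane :: "'a surface \<Rightarrow> 'a \<Rightarrow> (real^3) set" where
  "tangent_plane M m =
     {frechet_derivative (imm M \<circ> x) (at u) \<xi> | U x u \<xi>. chart_at M m U x u}"

definition pos_oriented :: "'a surface \<Rightarrow> 'a \<Rightarrow> real^3 \<Rightarrow> real^3 \<Rightarrow> bool" where
  "pos_oriented M m a b \<longleftrightarrow>
     (\<exists>U x u \<xi> \<eta>. chart_at M m U x u \<and>
        a = frechet_derivative (imm M \<circ> x) (at u) \<xi> \<and>
        b = frechet_derivative (imm M \<circ> x) (at u) \<eta> \<and>
        det (vector [\<xi>, \<eta>] :: real^2^2) > 0)"

definition rot90 :: "'a surface \<Rightarrow> 'a \<Rightarrow> real^3 \<Rightarrow> real^3" where
  "rot90 M m v = (THE w. w \<in> tangent_plane M m \<and> orthogonal v w \<and> norm w = norm v \<and>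
     (v \<noteq> 0 \<longrightarrow> pos_oriented M m v w))"

text \<open>Vector fields along the immersion are functions from the surface to Euclidean 3-space.
  \<open>dir_deriv M m Y X\<close> is \<open>D\<^sub>X Y\<close> at \<open>m\<close>, for \<open>X\<close> tangent at \<open>m\<close>; it is independent of the
  chart whenever \<open>Y\<close> is differentiable at \<open>m\<close>.\<close>

definition differentiable_field_at :: "'a surface \<Rightarrow> 'a \<Rightarrow> ('a \<Rightarrow> real^3) \<Rightarrow> bool" where
  "differentiable_field_at M m Y \<longleftrightarrow>
     (\<forall>U x u. chart_at M m U x u \<longrightarrow> (Y \<circ> x) differentiable (at u))"

definition dir_deriv :: "'a surface \<Rightarrow> 'a \<Rightarrow> ('a \<Rightarrow> real^3) \<Rightarrow> real^3 \<Rightarrow> real^3" where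
  "dir_deriv M m Y X = (THE w. \<exists>U x u \<xi>. chart_at M m U x u \<and>
     frechet_derivative (imm M \<circ> x) (at u) \<xi> = X \<and>
     w = frechet_derivative (Y \<circ> x) (at u) \<xi>)"

definition tangent_field_near :: "'a surface \<Rightarrow> 'a \<Rightarrow> ('a \<Rightarrow> real^3) \<Rightarrow> bool" where
  "tangent_field_near M m Y \<longleftrightarrow>
     (\<exists>W. openin (space_top M) W \<and> m \<in> W \<and> (\<forall>q\<in>W. Y q \<in> tangent_plane M q)) \<and>
     differentiable_field_at M m Y"

definition normal_component :: "'a surface \<Rightarrow> 'a \<Rightarrow> real^3 \<Rightarrow> real^3" where
  "normal_component M m w =
     (THE n. n \<in> (tangent_plane M m)\<^sup>\<bottom> \<and> w - n \<in> tangent_plane M m)"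

text \<open>The second fundamental form at \<open>m\<close>, for \<open>X\<close> and \<open>Y\<close> tangent at \<open>m\<close>: the vector \<open>Y\<close> is
  extended to a tangent field; the value does not depend on the extension.\<close>

definition second_fundamental_form ::
  "'a surface \<Rightarrow> 'a \<Rightarrow> real^3 \<Rightarrow> real^3 \<Rightarrow> real^3" where
  "second_fundamental_form M m X Y =
     (THE w. \<exists>Z. tangent_field_near M m Z \<and> Z m = Y \<and>
        w = normal_component M m (dir_deriv M m Z X))"

definition unit_normal :: "'a surface \<Rightarrow> 'a \<Rightarrow> real^3" where
  "unit_normal M q = (THE n. norm n = 1 \<and> n \<in> (tangent_plane M q)\<^sup>\<bottom> \<and>
     (\<forall>a b. pos_oriented M q a b \<longrightarrow> det (vector [a, b, n] :: real^3^3) > 0))"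

definition shape_operator :: "'a surface \<Rightarrow> 'a \<Rightarrow> real^3 \<Rightarrow> real^3" where
  "shape_operator M m X = - dir_deriv M m (unit_normal M) X"

definition principal_direction :: "'a surface \<Rightarrow> 'a \<Rightarrow> real \<Rightarrow> real^3 \<Rightarrow> bool" where
  "principal_direction M m k t \<longleftrightarrow>
     t \<in> tangent_plane M m \<and> t \<noteq> 0 \<and> shape_operator M m t = k *\<^sub>R t"

definition principal_curvatures :: "'a surface \<Rightarrow> 'a \<Rightarrow> real set" where
  "principal_curvatures M m = {k. \<exists>t. principal_direction M m k t}"

definition lateral_deviation :: "'a surface \<Rightarrow> 'a \<Rightarrow> real^3 \<Rightarrow> real" where
  "lateral_deviation M m v =
     - (1/6) * (second_fundamental_form M m (rot90 M m v) v \<bullet> second_fundamental_form M m v v)"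

definition unit_dir :: "real^3 \<Rightarrow> real^3 \<Rightarrow> real \<Rightarrow> real^3" where
  "unit_dir t1 t2 \<theta> = cos \<theta> *\<^sub>R t1 + sin \<theta> *\<^sub>R t2"

text \<open>Here \<open>(t1, t2)\<close> is meant to be an orthonormal basis of the tangent plane at \<open>m\<close>.\<close>

definition extremal_direction ::
  "'a surface \<Rightarrow> 'a \<Rightarrow> real^3 \<Rightarrow> real^3 \<Rightarrow> real \<Rightarrow> bool" where
  "extremal_direction M m t1 t2 \<theta>0 \<longleftrightarrow>
     ((\<lambda>\<theta>. lateral_deviation M m (unit_dir t1 t2 \<theta>)) has_real_derivative 0) (at \<theta>0)"

end

theory Submission
  imports Defs
begin

text \<open>
  In the principal basis everything becomes explicit. Let \<open>N\<close> be the positive unit normal and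
  \<open>S = - dN\<close> the shape operator. Differentiating \<open>Z \<bullet> N = 0\<close> for a tangent field \<open>Z\<close> gives
  \<open>\<alpha>(X, Y) = (S X \<bullet> Y) N\<close> (\<open>second_fundamental_form_eq\<close>), and the positive rotation of the tangent
  plane is \<open>v \<mapsto> N \<times> v\<close> (\<open>rot90_eq_cross\<close>). Since \<open>t1\<close>, \<open>t2\<close> are eigenvectors of \<open>S\<close> and
  \<open>t1 \<times> t2 = N\<close>, the vector \<open>v = cos \<theta> t1 + sin \<theta> t2\<close> has \<open>J v = - sin \<theta> t1 + cos \<theta> t2\<close> and
  the lateral deviation in the direction \<open>v\<close> is
  \<open>- (1/6) (k2 - k1) sin \<theta> cos \<theta> (k1 cos\<^sup>2 \<theta> + k2 sin\<^sup>2 \<theta>)\<close>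
  (\<open>lateral_deviation_principal_basis\<close>). Its derivative, after the substitution
  \<open>sin \<theta> = p cos \<theta>\<close>, is \<open>- (1/6) cos\<^sup>4 \<theta>\<close> times the polynomial of the theorem.

  The geometric notions quantify over all charts or over all extensions of a vector, so most of
  the work is to see that they are well defined. The source of all chart independence is
  \<open>chart_change\<close>: the differentials of any field in two charts at the same point differ by one
  linear map of positive determinant. In a single chart \<open>x\<close> the normal is the normalized cross
  product of the two partial derivatives of \<open>imm M \<circ> x\<close>, which is differentiable, and the tangent
  plane is its orthogonal plane for dimension reasons.
\<close>

section \<open>Linear algebra of the plane and of space\<close>

lemma real2_basis: "\<xi> = \<xi>$1 *\<^sub>R axis 1 1 + \<xi>$2 *\<^sub>R axis 2 (1::real)" for \<xi> :: "real^2"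
  by (simp add: vec_eq_iff forall_2 axis_def)

lemma linear_real2:
  fixes F :: "real^2 \<Rightarrow> 'b::real_vector"
  assumes "linear F"
  shows "F \<xi> = \<xi>$1 *\<^sub>R F (axis 1 1) + \<xi>$2 *\<^sub>R F (axis 2 1)"
  by (subst real2_basis) (simp only: linear_add[OF assms] linear_cmul[OF assms])

lemma cross_linear_images:
  fixes F :: "real^2 \<Rightarrow> real^3"
  assumes "linear F"
  shows "cross3 (F \<xi>) (F \<eta>) =
    det (vector [\<xi>, \<eta>] :: real^2^2) *\<^sub>R cross3 (F (axis 1 1)) (F (axis 2 1))"
  unfolding linear_real2[OF assms, of \<xi>] linear_real2[OF assms, of \<eta>]
  by (simp add: det_2 cross3_simps)

lemma det_vector_linear_images:
  fixes L :: "real^2 \<Rightarrow> real^2"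
  assumes "linear L"
  shows "det (vector [L \<xi>, L \<eta>] :: real^2^2) =
    det (matrix L) * det (vector [\<xi>, \<eta>] :: real^2^2)"
  unfolding linear_real2[OF assms, of \<xi>] linear_real2[OF assms, of \<eta>]
  by (simp add: det_2 matrix_def algebra_simps)

lemma cross_linear_images_nonzero:
  fixes F :: "real^2 \<Rightarrow> real^3"
  assumes "linear F" "inj F"
  shows "cross3 (F (axis 1 1)) (F (axis 2 1)) \<noteq> 0"
proof
  assume "cross3 (F (axis 1 1)) (F (axis 2 1)) = 0"
  then have "collinear {0, F (axis 1 1), F (axis 2 1)}"
    by (simp add: cross_eq_0)
  moreover have "F (axis 1 1) \<noteq> 0"
    using assms by (metis axis_eq_0_iff linear_injective_0 zero_neq_one)
  ultimately obtain c where "F (axis 2 1) = c *\<^sub>R F (axis 1 1)"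
    by (auto simp: collinear_lemma)
  then have "F (axis 2 1) = F (c *\<^sub>R axis 1 1)"
    by (simp add: linear_cmul[OF assms(1)])
  then have "axis 2 (1::real) = c *\<^sub>R (axis 1 1 :: real^2)"
    using assms(2) by (auto dest: injD)
  then show False
    by (simp add: vec_eq_iff forall_2 axis_def)
qed

lemma range_linear_eq_normal_plane:
  fixes F :: "real^2 \<Rightarrow> real^3"
  assumes "linear F" "inj F"
  shows "range F = {w. cross3 (F (axis 1 1)) (F (axis 2 1)) \<bullet> w = 0}" (is "_ = {w. ?n \<bullet> w = 0}")
proof (rule subspace_dim_equal)
  show "subspace (range F)"
    by (simp add: assms(1) linear_subspace_image subspace_UNIV)
  show "subspace {w. ?n \<bullet> w = 0}"
    by (rule subspace_hyperplane)
  show "range F \<subseteq> {w. ?n \<bullet> w = 0}"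
  proof clarsimp
    fix \<xi>
    show "?n \<bullet> F \<xi> = 0"
      unfolding linear_real2[OF assms(1), of \<xi>] by (simp add: inner_add_right dot_cross_self)
  qed
  have "dim (range F) = 2"
    using dim_image_eq[OF assms(1), of UNIV] assms(2) by (simp add: inj_on_subset)
  moreover have "dim {w. ?n \<bullet> w = 0} = 2"
    using dim_hyperplane[OF cross_linear_images_nonzero[OF assms]] by simp
  ultimately show "dim {w. ?n \<bullet> w = 0} \<le> dim (range F)"
    by simp
qed

text \<open>Two applications of the double cross product formula: \<open>n \<times> (v \<times> w) = 0\<close>, so \<open>v \<times> w\<close> is a
  multiple of \<open>n\<close>, and it has norm one; the sign is decided by the last hypothesis.\<close>

lemma cross_unit_triple:
  fixes v w n :: "real^3"
  assumes "norm v = 1" "norm w = 1" "norm n = 1" "v \<bullet> w = 0" "n \<bullet> v = 0" "n \<bullet> w = 0"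
    and pos: "cross3 v w \<bullet> n > 0"
  shows "cross3 v w = n"
proof -
  let ?c = "cross3 v w"
  have "cross3 n ?c = (n \<bullet> w) *\<^sub>R v - (n \<bullet> v) *\<^sub>R w"
    by (rule Lagrange)
  then have "cross3 n ?c = 0"
    using assms by simp
  moreover have "cross3 n (cross3 n ?c) = (n \<bullet> ?c) *\<^sub>R n - (n \<bullet> n) *\<^sub>R ?c"
    by (rule Lagrange)
  ultimately have c: "?c = (?c \<bullet> n) *\<^sub>R n"
    using assms(3) by (simp add: norm_eq_1 inner_commute)
  have "norm ?c = 1"
    using norm_cross_dot[of v w] assms(1,2,4) by (simp add: abs_square_eq_1)
  then have "\<bar>?c \<bullet> n\<bar> = 1"
    using c assms(3) by (metis mult.right_neutral norm_scaleR)
  with pos have "?c \<bullet> n = 1"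
    by simp
  then show ?thesis
    using c by simp
qed

lemma det_vector_eq_cross_inner:
  "det (vector [a, b, n] :: real^3^3) = cross3 a b \<bullet> n"
  by (simp add: cross3_simps)

section \<open>Change of charts\<close>

abbreviation chart_deriv :: "'a surface \<Rightarrow> (real^2 \<Rightarrow> 'a) \<Rightarrow> real^2 \<Rightarrow> real^2 \<Rightarrow> real^3" where
  "chart_deriv M x u \<equiv> frechet_derivative (imm M \<circ> x) (at u)"

lemma chart_atD:
  assumes "oriented_immersed_surface M" "chart_at M m U x u"
  shows "open U" "u \<in> U" "x u = m" "inj_on x U"
    "continuous_map (top_of_set U) (space_top M) x"
    "smooth_on (imm M \<circ> x) U"
    "(imm M \<circ> x) differentiable (at u)"
    "linear (chart_deriv M x u)"
    "inj (chart_deriv M x u)"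
proof -
  have c: "(U, x) \<in> charts M" "u \<in> U" "x u = m"
    using assms(2) by (auto simp: chart_at_def)
  have e: "embedding_map (top_of_set U) (space_top M) x"
    and s: "smooth_on (imm M \<circ> x) U"
    and i: "\<forall>u\<in>U. inj (chart_deriv M x u)"
    and o: "open U"
    using assms(1) c(1) unfolding oriented_immersed_surface_def by fast+
  have "Ck_on (Suc 0) (imm M \<circ> x) U"
    using s unfolding smooth_on_def by blast
  then show d: "(imm M \<circ> x) differentiable (at u)"
    using c by auto
  then show "linear (chart_deriv M x u)"
    by (rule linear_frechet_derivative)
  have h: "homeomorphic_map (top_of_set U) (subtopology (space_top M) (x ` U)) x"
    using e by (simp add: embedding_map_def)
  show "inj_on x U"
    using homeomorphic_imp_injective_map[OF h] by simp
  show "continuous_map (top_of_set U) (space_top M) x"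
    using homeomorphic_imp_continuous_map[OF h] by (simp add: continuous_map_in_subtopology)
  show "open U" "u \<in> U" "x u = m" "smooth_on (imm M \<circ> x) U"
    by fact+
  show "inj (chart_deriv M x u)"
    using i c(2) by blast
qed

lemma chart_atI:
  assumes "oriented_immersed_surface M" "m \<in> topspace (space_top M)"
  obtains U x u where "chart_at M m U x u"
proof -
  have "topspace (space_top M) = (\<Union>(U, x)\<in>charts M. x ` U)"
    using assms(1) unfolding oriented_immersed_surface_def by blast
  then obtain U x u where "(U, x) \<in> charts M" "u \<in> U" "x u = m"
    using assms(2) by auto
  then show ?thesis
    using that unfolding chart_at_def by blast
qed

text \<open>The same \<open>L\<close>, the differential of the transition map, serves every field \<open>Y\<close>. Taking the
  immersion for \<open>Y\<close> compares tangent vectors in the two charts, taking another field compares the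
  derivatives of that field along them.\<close>

lemma chart_change:
  fixes M :: "'a surface"
  assumes "oriented_immersed_surface M" "chart_at M m U x u" "chart_at M m V y v"
  obtains L where "linear L" "det (matrix L) > 0"
    and "\<And>Y :: 'a \<Rightarrow> real^3. (Y \<circ> y) differentiable (at v) \<Longrightarrow>
      ((Y \<circ> x) has_derivative frechet_derivative (Y \<circ> y) (at v) \<circ> L) (at u)"
proof -
  let ?\<phi> = "inv_into V y \<circ> x" and ?O = "{u \<in> U. x u \<in> y ` V}"
  let ?L = "frechet_derivative ?\<phi> (at u)"
  have c: "(U, x) \<in> charts M" "u \<in> U" "x u = m" "(V, y) \<in> charts M" "v \<in> V" "y v = m"
    using assms(2,3) by (auto simp: chart_at_def)
  have "\<forall>(U, x)\<in>charts M. \<forall>(V, y)\<in>charts M.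
      smooth_on (inv_into V y \<circ> x) {u \<in> U. x u \<in> y ` V} \<and>
      (\<forall>u\<in>U. x u \<in> y ` V \<longrightarrow> det (matrix (frechet_derivative (inv_into V y \<circ> x) (at u))) > 0)"
    using assms(1) unfolding oriented_immersed_surface_def by (elim conjE) assumption
  from bspec[OF this c(1)]
  have "\<forall>(V, y)\<in>charts M. smooth_on (inv_into V y \<circ> x) {u \<in> U. x u \<in> y ` V} \<and>
      (\<forall>u\<in>U. x u \<in> y ` V \<longrightarrow> det (matrix (frechet_derivative (inv_into V y \<circ> x) (at u))) > 0)"
    by (simp only: prod.case)
  from bspec[OF this c(4)]
  have s: "smooth_on ?\<phi> ?O" and "\<forall>u\<in>U. x u \<in> y ` V \<longrightarrow>
      det (matrix (frechet_derivative ?\<phi> (at u))) > 0"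
    unfolding prod.case by blast+
  moreover have xu: "x u \<in> y ` V"
    using c(3,5,6) by (metis imageI)
  ultimately have pos: "det (matrix ?L) > 0"
    using c(2) by blast
  have uO: "u \<in> ?O"
    using c(2) xu by simp
  have oO: "open ?O" and "Ck_on (Suc 0) ?\<phi> ?O"
    using s unfolding smooth_on_def by blast+
  then have d: "?\<phi> differentiable (at u)"
    using uO by auto
  have v: "?\<phi> u = v"
    using chart_atD(4)[OF assms(1,3)] c by (metis comp_apply inv_into_f_f)
  show thesis
  proof
    show "linear ?L"
      using d by (rule linear_frechet_derivative)
    show "det (matrix ?L) > 0"
      by (rule pos)
    fix Y :: "'a \<Rightarrow> real^3"
    assume "(Y \<circ> y) differentiable (at v)"
    then have "((Y \<circ> y) has_derivative frechet_derivative (Y \<circ> y) (at v)) (at (?\<phi> u))"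
      by (simp add: v[unfolded comp_def] flip: frechet_derivative_works)
    then have "((Y \<circ> y) \<circ> ?\<phi> has_derivative frechet_derivative (Y \<circ> y) (at v) \<circ> ?L) (at u)"
      using d by (intro diff_chain_at) (simp_all flip: frechet_derivative_works)
    then show "(Y \<circ> x has_derivative frechet_derivative (Y \<circ> y) (at v) \<circ> ?L) (at u)"
      by (rule has_derivative_transform_within_open[OF _ oO uO]) (auto simp: f_inv_into_f)
  qed
qed

lemma tangent_plane_eq_range:
  assumes "oriented_immersed_surface M" "chart_at M m U x u"
  shows "tangent_plane M m = range (chart_deriv M x u)"
proof
  show "range (chart_deriv M x u) \<subseteq> tangent_plane M m"
    using assms(2) by (auto simp: tangent_plane_def)
  show "tangent_plane M m \<subseteq> range (chart_deriv M x u)"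
  proof
    fix w assume "w \<in> tangent_plane M m"
    then obtain V y v \<xi> where c: "chart_at M m V y v" and w: "w = chart_deriv M y v \<xi>"
      by (auto simp: tangent_plane_def)
    obtain L where "(imm M \<circ> y has_derivative chart_deriv M x u \<circ> L) (at v)"
      using chart_change[OF assms(1) c assms(2)] chart_atD(7)[OF assms] by metis
    then have "chart_deriv M y v = chart_deriv M x u \<circ> L"
      using frechet_derivative_at by metis
    then show "w \<in> range (chart_deriv M x u)"
      using w by simp
  qed
qed

text \<open>A tangent vector has one coordinate vector in each chart because the immersion has injective
  differential, and a chart change transforms the coordinate vectors for \<open>imm M\<close> and for \<open>Y\<close> by
  the same \<open>L\<close>.\<close>

lemma dir_deriv_eq_chart:
  fixes M :: "'a surface" and Y :: "'a \<Rightarrow> real^3"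
  assumes "oriented_immersed_surface M" "chart_at M m U x u"
    and "(Y \<circ> x) differentiable (at u)"
  shows "dir_deriv M m Y (chart_deriv M x u \<xi>) = frechet_derivative (Y \<circ> x) (at u) \<xi>"
  unfolding dir_deriv_def
proof (rule the_equality)
  show "\<exists>V y v \<eta>. chart_at M m V y v \<and> chart_deriv M y v \<eta> = chart_deriv M x u \<xi> \<and>
    frechet_derivative (Y \<circ> x) (at u) \<xi> = frechet_derivative (Y \<circ> y) (at v) \<eta>"
    using assms(2) by blast
next
  fix w
  assume "\<exists>V y v \<eta>. chart_at M m V y v \<and> chart_deriv M y v \<eta> = chart_deriv M x u \<xi> \<and>
    w = frechet_derivative (Y \<circ> y) (at v) \<eta>"
  then obtain V y v \<eta> where c: "chart_at M m V y v"
    and eq: "chart_deriv M y v \<eta> = chart_deriv M x u \<xi>"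
    and w: "w = frechet_derivative (Y \<circ> y) (at v) \<eta>"
    by blast
  obtain L where "linear L" "det (matrix L) > 0" and
    L: "\<And>Z :: 'a \<Rightarrow> real^3. (Z \<circ> x) differentiable (at u) \<Longrightarrow>
      ((Z \<circ> y) has_derivative frechet_derivative (Z \<circ> x) (at u) \<circ> L) (at v)"
    using chart_change[OF assms(1) c assms(2)] by blast
  have "chart_deriv M y v = chart_deriv M x u \<circ> L"
    using L chart_atD(7)[OF assms(1,2)] frechet_derivative_at by metis
  then have "L \<eta> = \<xi>"
    using eq chart_atD(9)[OF assms(1,2)] by (auto dest: injD)
  moreover have "frechet_derivative (Y \<circ> y) (at v) = frechet_derivative (Y \<circ> x) (at u) \<circ> L"
    using L assms(3) frechet_derivative_at by metis
  ultimately show "w = frechet_derivative (Y \<circ> x) (at u) \<xi>"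
    using w by simp
qed

section \<open>The unit normal field\<close>

definition chart_normal :: "'a surface \<Rightarrow> (real^2 \<Rightarrow> 'a) \<Rightarrow> real^2 \<Rightarrow> real^3" where
  "chart_normal M x u =
    sgn (cross3 (chart_deriv M x u (axis 1 1)) (chart_deriv M x u (axis 2 1)))"

lemma chart_normal_props:
  assumes "oriented_immersed_surface M" "chart_at M m U x u"
  shows "norm (chart_normal M x u) = 1"
    and "tangent_plane M m = {w. chart_normal M x u \<bullet> w = 0}"
    and "\<exists>r>0. \<forall>\<xi> \<eta>. cross3 (chart_deriv M x u \<xi>) (chart_deriv M x u \<eta>) =
      (r * det (vector [\<xi>, \<eta>] :: real^2^2)) *\<^sub>R chart_normal M x u"
proof -
  let ?F = "chart_deriv M x u"
  let ?c = "cross3 (?F (axis 1 1)) (?F (axis 2 1))"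
  have F: "linear ?F" "inj ?F"
    using chart_atD[OF assms] by auto
  have c: "?c \<noteq> 0"
    by (rule cross_linear_images_nonzero[OF F])
  then show "norm (chart_normal M x u) = 1"
    by (simp add: chart_normal_def norm_sgn)
  show "tangent_plane M m = {w. chart_normal M x u \<bullet> w = 0}"
    using c unfolding tangent_plane_eq_range[OF assms] range_linear_eq_normal_plane[OF F]
    by (simp add: chart_normal_def sgn_div_norm)
  have "cross3 (?F \<xi>) (?F \<eta>) =
      (norm ?c * det (vector [\<xi>, \<eta>] :: real^2^2)) *\<^sub>R chart_normal M x u" for \<xi> \<eta>
    using c by (simp add: cross_linear_images[OF F(1), of \<xi>] chart_normal_def sgn_div_norm)
  moreover have "norm ?c > 0"
    using c by simp
  ultimately show "\<exists>r>0. \<forall>\<xi> \<eta>. cross3 (?F \<xi>) (?F \<eta>) =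
      (r * det (vector [\<xi>, \<eta>] :: real^2^2)) *\<^sub>R chart_normal M x u"
    by blast
qed

text \<open>This exchanges the orientation of coordinate vectors for the orientation of triples in space.
  Transition maps of positive determinant make the condition in some chart imply it in the chart
  \<open>x\<close>.\<close>

lemma pos_oriented_iff_chart:
  assumes "oriented_immersed_surface M" "chart_at M m U x u"
  shows "pos_oriented M m a b \<longleftrightarrow>
    a \<in> tangent_plane M m \<and> b \<in> tangent_plane M m \<and> cross3 a b \<bullet> chart_normal M x u > 0"
proof -
  let ?F = "chart_deriv M x u" and ?n = "chart_normal M x u"
  obtain r where r: "r > 0" "\<And>\<xi> \<eta>. cross3 (?F \<xi>) (?F \<eta>) =
      (r * det (vector [\<xi>, \<eta>] :: real^2^2)) *\<^sub>R ?n"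
    using chart_normal_props(3)[OF assms] by metis
  have sign: "cross3 (?F \<xi>) (?F \<eta>) \<bullet> ?n > 0 \<longleftrightarrow> det (vector [\<xi>, \<eta>] :: real^2^2) > 0" for \<xi> \<eta>
    using r chart_normal_props(1)[OF assms] by (simp add: norm_eq_1 zero_less_mult_iff)
  show ?thesis
  proof
    assume "pos_oriented M m a b"
    then obtain V y v \<xi> \<eta> where c: "chart_at M m V y v"
      and ab: "a = chart_deriv M y v \<xi>" "b = chart_deriv M y v \<eta>"
      and d: "det (vector [\<xi>, \<eta>] :: real^2^2) > 0"
      unfolding pos_oriented_def by blast
    obtain L where L: "linear L" "det (matrix L) > 0"
      "(imm M \<circ> y has_derivative ?F \<circ> L) (at v)"
      using chart_change[OF assms(1) c assms(2)] chart_atD(7)[OF assms] by metis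
    then have "chart_deriv M y v = ?F \<circ> L"
      using frechet_derivative_at by metis
    moreover have "det (vector [L \<xi>, L \<eta>] :: real^2^2) > 0"
      using d L by (simp add: det_vector_linear_images)
    ultimately show "a \<in> tangent_plane M m \<and> b \<in> tangent_plane M m \<and> cross3 a b \<bullet> ?n > 0"
      using ab by (auto simp: tangent_plane_eq_range[OF assms] sign)
  next
    assume "a \<in> tangent_plane M m \<and> b \<in> tangent_plane M m \<and> cross3 a b \<bullet> ?n > 0"
    then show "pos_oriented M m a b"
      using assms(2) sign unfolding tangent_plane_eq_range[OF assms] pos_oriented_def by blast
  qed
qed

text \<open>Orthogonality to the plane leaves only two unit vectors; the pair of partial derivatives of the
  chart is positively oriented and selects one of them.\<close>

lemma unit_normal_eq_chart_normal:
  assumes "oriented_immersed_surface M" "chart_at M m U x u"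
  shows "unit_normal M m = chart_normal M x u"
  unfolding unit_normal_def
proof (rule the_equality)
  let ?n = "chart_normal M x u"
  note n1 = chart_normal_props(1)[OF assms] and T = chart_normal_props(2)[OF assms]
    and pos = pos_oriented_iff_chart[OF assms]
  show "norm ?n = 1 \<and> ?n \<in> (tangent_plane M m)\<^sup>\<bottom> \<and>
    (\<forall>a b. pos_oriented M m a b \<longrightarrow> det (vector [a, b, ?n] :: real^3^3) > 0)"
    by (auto simp: n1 T pos orthogonal_comp_def orthogonal_def inner_commute
        det_vector_eq_cross_inner)
  fix n
  assume n: "norm n = 1 \<and> n \<in> (tangent_plane M m)\<^sup>\<bottom> \<and>
    (\<forall>a b. pos_oriented M m a b \<longrightarrow> det (vector [a, b, n] :: real^3^3) > 0)"
  \<comment> \<open>The tangential part of \<open>n\<close>; it is orthogonal to \<open>n\<close> and to the chart normal, hence zero.\<close>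
  define w where "w = n - (?n \<bullet> n) *\<^sub>R ?n"
  have "?n \<bullet> w = 0"
    using n1 by (simp add: w_def inner_diff_right norm_eq_1)
  moreover from this have "w \<bullet> n = 0"
    using n by (auto simp: T orthogonal_comp_def orthogonal_def)
  ultimately have "w \<bullet> w = 0"
    by (simp add: w_def inner_diff_right inner_diff_left inner_commute)
  then have n_eq: "n = (?n \<bullet> n) *\<^sub>R ?n"
    by (simp add: w_def)
  then have "\<bar>?n \<bullet> n\<bar> = 1"
    using n n1 by (metis mult.right_neutral norm_scaleR)
  moreover have "?n \<bullet> n > 0"
  proof -
    obtain r where r: "r > 0" "\<And>\<xi> \<eta>. cross3 (chart_deriv M x u \<xi>) (chart_deriv M x u \<eta>) =
        (r * det (vector [\<xi>, \<eta>] :: real^2^2)) *\<^sub>R ?n"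
      using chart_normal_props(3)[OF assms] by metis
    have e: "det (vector [axis 1 1, axis 2 1] :: real^2^2) > 0"
      by (simp add: det_2 axis_def)
    then have "pos_oriented M m (chart_deriv M x u (axis 1 1)) (chart_deriv M x u (axis 2 1))"
      using assms(2) unfolding pos_oriented_def by blast
    then have "cross3 (chart_deriv M x u (axis 1 1)) (chart_deriv M x u (axis 2 1)) \<bullet> n > 0"
      using n by (metis det_vector_eq_cross_inner)
    then have "0 < (r * det (vector [axis 1 1, axis 2 1] :: real^2^2)) * (?n \<bullet> n)"
      by (simp add: r(2))
    then show ?thesis
      by (rule zero_less_mult_pos) (use r(1) e in simp)
  qed
  ultimately show "n = ?n"
    using n_eq by simp
qed

lemma
  assumes "oriented_immersed_surface M" "m \<in> topspace (space_top M)"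
  shows norm_unit_normal: "norm (unit_normal M m) = 1"
    and tangent_plane_eq_normal_plane: "tangent_plane M m = {w. unit_normal M m \<bullet> w = 0}"
    and pos_oriented_iff: "pos_oriented M m a b \<longleftrightarrow>
      a \<in> tangent_plane M m \<and> b \<in> tangent_plane M m \<and> cross3 a b \<bullet> unit_normal M m > 0"
proof -
  obtain U x u where c: "chart_at M m U x u"
    using chart_atI[OF assms] .
  show "norm (unit_normal M m) = 1" "tangent_plane M m = {w. unit_normal M m \<bullet> w = 0}"
    "pos_oriented M m a b \<longleftrightarrow>
      a \<in> tangent_plane M m \<and> b \<in> tangent_plane M m \<and> cross3 a b \<bullet> unit_normal M m > 0"
    unfolding unit_normal_eq_chart_normal[OF assms(1) c]
    using chart_normal_props[OF assms(1) c] pos_oriented_iff_chart[OF assms(1) c] by blast+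
qed

text \<open>The normal is an expression in the first derivatives of the immersion, and these are
  differentiable because the immersion is twice differentiable in charts. The chart formula is available at every point of \<open>U\<close>, because
  \<open>x\<close> is a chart at all of them.\<close>

lemma unit_normal_differentiable:
  assumes "oriented_immersed_surface M" "chart_at M m U x u"
  shows "(unit_normal M \<circ> x) differentiable (at u)"
proof -
  note U = chart_atD[OF assms]
  let ?c = "\<lambda>u. cross3 (chart_deriv M x u (axis 1 1)) (chart_deriv M x u (axis 2 1))"
  have "Ck_on (Suc (Suc 0)) (imm M \<circ> x) U"
    using U(6) unfolding smooth_on_def by blast
  then have "(\<lambda>u. chart_deriv M x u e) differentiable (at u)" for e
    using U(2) by auto
  then obtain A B where
    "((\<lambda>u. chart_deriv M x u (axis 1 1)) has_derivative A) (at u)"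
    "((\<lambda>u. chart_deriv M x u (axis 2 1)) has_derivative B) (at u)"
    unfolding differentiable_def by metis
  moreover have "bounded_bilinear cross3"
    using bilinear_cross by (simp add: bilinear_conv_bounded_bilinear)
  ultimately have c: "?c differentiable (at u)"
    unfolding differentiable_def using bounded_bilinear.FDERIV by blast
  moreover have "?c u \<noteq> 0"
    using U by (intro cross_linear_images_nonzero)
  ultimately have "(\<lambda>u. inverse (norm (?c u)) *\<^sub>R ?c u) differentiable (at u)"
    by (intro differentiable_scaleR differentiable_inverse
        differentiable_compose[of norm ?c] differentiable_norm_at) simp_all
  then obtain D where "((\<lambda>u. inverse (norm (?c u)) *\<^sub>R ?c u) has_derivative D) (at u)"
    unfolding differentiable_def by blast
  then have "((unit_normal M \<circ> x) has_derivative D) (at u)"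
  proof (rule has_derivative_transform_within_open[OF _ U(1,2)])
    fix u' assume "u' \<in> U"
    then have "chart_at M (x u') U x u'"
      using assms(2) by (simp add: chart_at_def)
    then show "inverse (norm (?c u')) *\<^sub>R ?c u' = (unit_normal M \<circ> x) u'"
      by (simp add: unit_normal_eq_chart_normal[OF assms(1)] chart_normal_def sgn_div_norm)
  qed
  then show ?thesis
    by (rule differentiableI)
qed

section \<open>The second fundamental form and the rotation in terms of the unit normal\<close>

lemma normal_component_eq:
  assumes "oriented_immersed_surface M" "m \<in> topspace (space_top M)"
  shows "normal_component M m w = (w \<bullet> unit_normal M m) *\<^sub>R unit_normal M m"
  unfolding normal_component_def
proof (rule the_equality)
  let ?n = "unit_normal M m"
  note n1 = norm_unit_normal[OF assms] and T = tangent_plane_eq_normal_plane[OF assms]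
  show "(w \<bullet> ?n) *\<^sub>R ?n \<in> (tangent_plane M m)\<^sup>\<bottom> \<and> w - (w \<bullet> ?n) *\<^sub>R ?n \<in> tangent_plane M m"
    using n1 by (auto simp: T orthogonal_comp_def orthogonal_def inner_commute
        inner_diff_right norm_eq_1)
  fix n'
  assume n': "n' \<in> (tangent_plane M m)\<^sup>\<bottom> \<and> w - n' \<in> tangent_plane M m"
  \<comment> \<open>The difference of two candidates is both tangent and normal.\<close>
  define d where "d = n' - (w \<bullet> ?n) *\<^sub>R ?n"
  have nd: "?n \<bullet> d = 0"
    using n' n1 by (simp add: T d_def inner_diff_right norm_eq_1 inner_commute)
  then have "d \<bullet> n' = 0"
    using n' by (auto simp: T orthogonal_comp_def orthogonal_def)
  then have "d \<bullet> d = 0"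
    using nd by (simp add: d_def inner_diff_right inner_commute)
  then show "n' = (w \<bullet> ?n) *\<^sub>R ?n"
    by (simp add: d_def)
qed

lemma shape_operator_eq_chart:
  assumes "oriented_immersed_surface M" "chart_at M m U x u"
  shows "shape_operator M m (chart_deriv M x u \<xi>) =
    - frechet_derivative (unit_normal M \<circ> x) (at u) \<xi>"
  by (simp add: shape_operator_def
      dir_deriv_eq_chart[OF assms unit_normal_differentiable[OF assms]])

lemma shape_operator_combination:
  assumes "oriented_immersed_surface M" "m \<in> topspace (space_top M)"
    and "X \<in> tangent_plane M m" "Y \<in> tangent_plane M m"
  shows "shape_operator M m (a *\<^sub>R X + b *\<^sub>R Y) =
    a *\<^sub>R shape_operator M m X + b *\<^sub>R shape_operator M m Y"
proof -
  obtain U x u where c: "chart_at M m U x u"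
    using chart_atI[OF assms(1,2)] .
  obtain \<xi> \<eta> where XY: "X = chart_deriv M x u \<xi>" "Y = chart_deriv M x u \<eta>"
    using assms(3,4) unfolding tangent_plane_eq_range[OF assms(1) c] by blast
  note F = chart_atD(8)[OF assms(1) c]
    and N = linear_frechet_derivative[OF unit_normal_differentiable[OF assms(1) c]]
  have "a *\<^sub>R X + b *\<^sub>R Y = chart_deriv M x u (a *\<^sub>R \<xi> + b *\<^sub>R \<eta>)"
    by (simp add: XY linear_add[OF F] linear_cmul[OF F])
  then show ?thesis
    by (simp add: XY shape_operator_eq_chart[OF assms(1) c] linear_add[OF N] linear_cmul[OF N])
qed

text \<open>The product rule applied to \<open>Z \<bullet> N = 0\<close>, which holds in a neighbourhood of the point. The right
  side depends on \<open>Z\<close> only through \<open>Z m\<close>; hence the second fundamental form is independent of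
  the extension.\<close>

lemma dir_deriv_inner_unit_normal:
  assumes "oriented_immersed_surface M" "m \<in> topspace (space_top M)"
    and "tangent_field_near M m Z" "X \<in> tangent_plane M m"
  shows "dir_deriv M m Z X \<bullet> unit_normal M m = shape_operator M m X \<bullet> Z m"
proof -
  obtain U x u where c: "chart_at M m U x u"
    using chart_atI[OF assms(1,2)] .
  note U = chart_atD[OF assms(1) c]
  obtain \<xi> where X: "X = chart_deriv M x u \<xi>"
    using assms(4) unfolding tangent_plane_eq_range[OF assms(1) c] by blast
  obtain W where W: "openin (space_top M) W" "m \<in> W" "\<And>q. q \<in> W \<Longrightarrow> Z q \<in> tangent_plane M q"
    using assms(3) unfolding tangent_field_near_def by blast
  have dZ: "(Z \<circ> x) differentiable (at u)"
    using assms(3) c unfolding tangent_field_near_def differentiable_field_at_def by blast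
  let ?dZ = "frechet_derivative (Z \<circ> x) (at u)"
    and ?dN = "frechet_derivative (unit_normal M \<circ> x) (at u)"
  have "((\<lambda>u. (Z \<circ> x) u \<bullet> (unit_normal M \<circ> x) u) has_derivative
      (\<lambda>h. (Z \<circ> x) u \<bullet> ?dN h + ?dZ h \<bullet> (unit_normal M \<circ> x) u)) (at u)"
    using dZ unit_normal_differentiable[OF assms(1) c]
    by (intro has_derivative_inner) (simp_all only: frechet_derivative_works)
  moreover have "((\<lambda>u. (Z \<circ> x) u \<bullet> (unit_normal M \<circ> x) u) has_derivative (\<lambda>h. 0)) (at u)"
  proof (rule has_derivative_transform_within_open[OF has_derivative_const[of 0]])
    have "openin (top_of_set U) {u \<in> topspace (top_of_set U). x u \<in> W}"
      using U(5) W(1) by (rule openin_continuous_map_preimage)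
    then show "open {u \<in> U. x u \<in> W}"
      using U(1) by (simp add: openin_open_eq)
    show "u \<in> {u \<in> U. x u \<in> W}"
      using U(2,3) W(2) by simp
    fix u' assume "u' \<in> {u \<in> U. x u \<in> W}"
    then have "Z (x u') \<in> tangent_plane M (x u')" "x u' \<in> topspace (space_top M)"
      using W openin_subset by auto
    then show "0 = (Z \<circ> x) u' \<bullet> (unit_normal M \<circ> x) u'"
      by (simp add: tangent_plane_eq_normal_plane[OF assms(1)] inner_commute)
  qed
  ultimately have "(\<lambda>h. (Z \<circ> x) u \<bullet> ?dN h + ?dZ h \<bullet> (unit_normal M \<circ> x) u) = (\<lambda>h. 0)"
    by (rule has_derivative_unique)
  then have "Z m \<bullet> ?dN \<xi> + ?dZ \<xi> \<bullet> unit_normal M m = 0"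
    using U(3) by (auto dest: fun_cong)
  then show ?thesis
    by (simp add: X dir_deriv_eq_chart[OF assms(1) c dZ] shape_operator_eq_chart[OF assms(1) c]
        inner_commute)
qed

text \<open>Projecting the constant field \<open>Y\<close> onto the tangent planes extends a tangent vector to the whole
  surface.\<close>

lemma tangent_field_exists:
  assumes "oriented_immersed_surface M" "m \<in> topspace (space_top M)"
    and "Y \<in> tangent_plane M m"
  obtains Z where "tangent_field_near M m Z" "Z m = Y"
proof -
  let ?Z = "\<lambda>q. Y - (Y \<bullet> unit_normal M q) *\<^sub>R unit_normal M q"
  have "\<forall>q\<in>topspace (space_top M). ?Z q \<in> tangent_plane M q"
    using norm_unit_normal[OF assms(1)]
    by (simp add: tangent_plane_eq_normal_plane[OF assms(1)] inner_diff_right norm_eq_1 inner_commute)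
  moreover have "differentiable_field_at M m ?Z"
    unfolding differentiable_field_at_def
  proof (intro allI impI)
    fix U x u assume "chart_at M m U x u"
    from unit_normal_differentiable[OF assms(1) this]
    have N: "(\<lambda>u. unit_normal M (x u)) differentiable (at u)"
      by (simp add: comp_def)
    show "(?Z \<circ> x) differentiable (at u)"
      unfolding comp_def by (intro differentiable_diff differentiable_const differentiable_scaleR
          differentiable_inner N)
  qed
  ultimately have "tangent_field_near M m ?Z"
    unfolding tangent_field_near_def using assms(2) by blast
  moreover have "?Z m = Y"
    using assms(3) by (simp add: tangent_plane_eq_normal_plane[OF assms(1,2)] inner_commute)
  ultimately show thesis
    by (rule that)
qed

lemma second_fundamental_form_eq:
  assumes "oriented_immersed_surface M" "m \<in> topspace (space_top M)"
    and "X \<in> tangent_plane M m" "Y \<in> tangent_plane M m"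
  shows "second_fundamental_form M m X Y = (shape_operator M m X \<bullet> Y) *\<^sub>R unit_normal M m"
  unfolding second_fundamental_form_def
proof (rule the_equality)
  have val: "normal_component M m (dir_deriv M m Z X) =
      (shape_operator M m X \<bullet> Y) *\<^sub>R unit_normal M m"
    if "tangent_field_near M m Z" "Z m = Y" for Z
    using that dir_deriv_inner_unit_normal[OF assms(1,2) that(1) assms(3)]
    by (simp add: normal_component_eq[OF assms(1,2)])
  then show "\<exists>Z. tangent_field_near M m Z \<and> Z m = Y \<and>
      (shape_operator M m X \<bullet> Y) *\<^sub>R unit_normal M m = normal_component M m (dir_deriv M m Z X)"
    using tangent_field_exists[OF assms(1,2,4)] by metis
  show "w = (shape_operator M m X \<bullet> Y) *\<^sub>R unit_normal M m"
    if "\<exists>Z. tangent_field_near M m Z \<and> Z m = Y \<and> w = normal_component M m (dir_deriv M m Z X)"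
    for w
    using that val by blast
qed

text \<open>A unit tangent \<open>w\<close> orthogonal to \<open>v\<close> with \<open>(v, w)\<close> positive must satisfy \<open>v \<times> w = N\<close>, and then
  \<open>N \<times> v = (v \<times> w) \<times> v = w\<close>.\<close>

lemma rot90_eq_cross:
  assumes "oriented_immersed_surface M" "m \<in> topspace (space_top M)"
    and "v \<in> tangent_plane M m" "norm v = 1"
  shows "rot90 M m v = cross3 (unit_normal M m) v"
  unfolding rot90_def
proof (rule the_equality)
  let ?n = "unit_normal M m"
  note n1 = norm_unit_normal[OF assms(1,2)] and T = tangent_plane_eq_normal_plane[OF assms(1,2)]
    and pos = pos_oriented_iff[OF assms(1,2)]
  have nv: "?n \<bullet> v = 0"
    using assms(3) by (simp add: T)
  have "cross3 v (cross3 ?n v) = ?n"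
    using nv assms(4) by (simp add: Lagrange inner_commute norm_eq_1)
  moreover have "norm (cross3 ?n v) = 1"
    using norm_cross_dot[of ?n v] nv n1 assms(4) by (simp add: abs_square_eq_1)
  ultimately show "cross3 ?n v \<in> tangent_plane M m \<and> orthogonal v (cross3 ?n v) \<and>
      norm (cross3 ?n v) = norm v \<and> (v \<noteq> 0 \<longrightarrow> pos_oriented M m v (cross3 ?n v))"
    using nv n1 assms(3,4)
    by (simp add: pos T dot_cross_self orthogonal_def flip: power2_norm_eq_inner)
  fix w
  assume "w \<in> tangent_plane M m \<and> orthogonal v w \<and> norm w = norm v \<and>
    (v \<noteq> 0 \<longrightarrow> pos_oriented M m v w)"
  moreover have "v \<noteq> 0"
    using assms(4) by auto
  ultimately have w: "?n \<bullet> w = 0" "v \<bullet> w = 0" "norm w = 1" "cross3 v w \<bullet> ?n > 0"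
    using assms(4) by (auto simp: T pos orthogonal_def)
  have "cross3 v w = ?n"
    using cross_unit_triple[of v w ?n] w nv n1 assms(4) by simp
  then have "cross3 ?n v = cross3 (cross3 v w) v"
    by simp
  also have "\<dots> = - cross3 v (cross3 v w)"
    by (rule cross_skew)
  also have "\<dots> = w"
    using w assms(4) by (simp add: Lagrange norm_eq_1)
  finally show "w = cross3 ?n v"
    by simp
qed

section \<open>The lateral deviation in a principal basis\<close>

text \<open>The shape operator is diagonal in the basis \<open>t1\<close>, \<open>t2\<close>, and \<open>\<alpha>(J v, v)\<close> and
  \<open>\<alpha>(v, v)\<close> are both multiples of the unit vector \<open>N\<close>, so their inner product is the product of
  the two coefficients.\<close>

lemma lateral_deviation_principal_basis:
  assumes S: "oriented_immersed_surface M" and m: "m \<in> topspace (space_top M)"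
    and p1: "principal_direction M m k1 t1" and p2: "principal_direction M m k2 t2"
    and u: "norm t1 = 1" "norm t2 = 1" "orthogonal t1 t2"
    and pos: "pos_oriented M m t1 t2"
  shows "lateral_deviation M m (unit_dir t1 t2 \<theta>) =
    - (1/6) * ((k2 - k1) * sin \<theta> * cos \<theta> * (k1 * (cos \<theta>)\<^sup>2 + k2 * (sin \<theta>)\<^sup>2))"
proof -
  let ?n = "unit_normal M m" and ?v = "unit_dir t1 t2 \<theta>"
  let ?w = "(- sin \<theta>) *\<^sub>R t1 + cos \<theta> *\<^sub>R t2"
  note n1 = norm_unit_normal[OF S m] and T = tangent_plane_eq_normal_plane[OF S m]
  have t: "t1 \<in> tangent_plane M m" "t2 \<in> tangent_plane M m"
    and s: "shape_operator M m t1 = k1 *\<^sub>R t1" "shape_operator M m t2 = k2 *\<^sub>R t2"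
    using p1 p2 by (auto simp: principal_direction_def)
  have ip: "t1 \<bullet> t1 = 1" "t2 \<bullet> t2 = 1" "t1 \<bullet> t2 = 0" "t2 \<bullet> t1 = 0"
    using u by (auto simp: norm_eq_1 orthogonal_def inner_commute)
  have n: "?n = cross3 t1 t2"
    using cross_unit_triple[of t1 t2 ?n] u n1 t pos
    by (simp add: T pos_oriented_iff[OF S m] orthogonal_def)
  have "cross3 ?n t1 = t2" "cross3 ?n t2 = - t1"
    unfolding n cross_skew[of "cross3 t1 t2"] by (simp_all add: Lagrange ip)
  then have w: "cross3 ?n ?v = ?w"
    by (simp add: unit_dir_def cross_add_right cross_mult_right)
  have vT: "?v \<in> tangent_plane M m" and wT: "?w \<in> tangent_plane M m"
    using t by (simp_all add: T unit_dir_def inner_add_right inner_diff_right)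
  have "?v \<bullet> ?v = 1"
    by (simp add: unit_dir_def inner_add_left inner_add_right ip flip: power2_eq_square)
  then have J: "rot90 M m ?v = ?w"
    using rot90_eq_cross[OF S m vT] w by (simp add: norm_eq_1)
  have Sv: "shape_operator M m ?v = (cos \<theta> * k1) *\<^sub>R t1 + (sin \<theta> * k2) *\<^sub>R t2"
    unfolding unit_dir_def by (simp only: shape_operator_combination[OF S m t] s scaleR_scaleR)
  have Sw: "shape_operator M m ?w = (- sin \<theta> * k1) *\<^sub>R t1 + (cos \<theta> * k2) *\<^sub>R t2"
    by (simp only: shape_operator_combination[OF S m t] s scaleR_scaleR)
  have "second_fundamental_form M m ?w ?v = ((k2 - k1) * sin \<theta> * cos \<theta>) *\<^sub>R ?n"
    unfolding second_fundamental_form_eq[OF S m wT vT] Sw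
    by (simp add: unit_dir_def inner_add_left inner_add_right ip algebra_simps)
  moreover have "second_fundamental_form M m ?v ?v =
      (k1 * (cos \<theta>)\<^sup>2 + k2 * (sin \<theta>)\<^sup>2) *\<^sub>R ?n"
    unfolding second_fundamental_form_eq[OF S m vT vT] Sv
    by (simp add: unit_dir_def inner_add_left inner_add_right ip power2_eq_square algebra_simps)
  ultimately show ?thesis
    using n1 by (simp add: lateral_deviation_def J norm_eq_1)
qed

theorem mainTheorem4:
  fixes M :: "'a surface" and m :: 'a and k1 k2 \<theta> p :: real and t1 t2 :: "real^3"
  assumes "oriented_immersed_surface M"
    and "m \<in> topspace (space_top M)"
    and "principal_curvatures M m = {k1, k2}"
    and "principal_direction M m k1 t1"
    and "principal_direction M m k2 t2"
    and "norm t1 = 1" and "norm t2 = 1" and "orthogonal t1 t2"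
    and "pos_oriented M m t1 t2"
    and "cos \<theta> \<noteq> 0"
    and "p = tan \<theta>"
  shows "extremal_direction M m t1 t2 \<theta> \<longleftrightarrow>
    (k2 - k1) * (- k2 * p ^ 4 + 3 * p\<^sup>2 * (k2 - k1) + k1) = 0"
proof -
  let ?c = "cos \<theta>" and ?s = "sin \<theta>"
  let ?q = "(k2 - k1) * (- k2 * p ^ 4 + 3 * p\<^sup>2 * (k2 - k1) + k1)"
  let ?f = "\<lambda>\<theta>. - (1/6) * ((k2 - k1) * sin \<theta> * cos \<theta> * (k1 * (cos \<theta>)\<^sup>2 + k2 * (sin \<theta>)\<^sup>2))"
  let ?D = "- (1/6) * (k2 - k1) *
    ((?c\<^sup>2 - ?s\<^sup>2) * (k1 * ?c\<^sup>2 + k2 * ?s\<^sup>2) + 2 * ?s\<^sup>2 * ?c\<^sup>2 * (k2 - k1))"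
  have f: "(\<lambda>\<theta>. lateral_deviation M m (unit_dir t1 t2 \<theta>)) = ?f"
    using lateral_deviation_principal_basis[OF assms(1,2,4-9)] by blast
  have D: "(?f has_real_derivative ?D) (at \<theta>)"
    by (rule derivative_eq_intros refl)+ (simp add: power2_eq_square field_simps)
  \<comment> \<open>Every term of the derivative has degree four in sine and cosine, so a factor \<open>cos\<^sup>4 \<theta>\<close> splits
    off and leaves a polynomial in \<open>p\<close>.\<close>
  have s: "?s = p * ?c"
    using assms(10,11) by (simp add: tan_def)
  have "?D = - (1/6) * ?c ^ 4 * ?q"
    unfolding s by algebra
  moreover have "- (1/6) * ?c ^ 4 \<noteq> 0"
    using assms(10) by simp
  ultimately have "?D = 0 \<longleftrightarrow> ?q = 0"
    by (simp only: mult_eq_0_iff[of "- (1/6) * ?c ^ 4" ?q] simp_thms)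
  moreover have "(?f has_real_derivative 0) (at \<theta>) \<longleftrightarrow> ?D = 0"
  proof
    assume "(?f has_real_derivative 0) (at \<theta>)"
    with D show "?D = 0"
      by (rule DERIV_unique)
  next
    assume "?D = 0"
    with D show "(?f has_real_derivative 0) (at \<theta>)"
      by (simp only:)
  qed
  ultimately show ?thesis
    unfolding extremal_direction_def f by (simp only:)
qed

end
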